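(* The class of $(K,\cdot,0)$-structures that are $(\dot\setminus,\cap,\emptyset)$-representable by sets is axiomatised by the finite set of axioms $\mathbf{Ax}(K,\cdot,0)$ defined in the context. The class of $(K,\cdot)$-structures that are $(\dot\setminus,\cap)$-representable by sets is axiomatised by the finite set of axioms $\mathbf{Ax}(K,\cdot)$ defined in the context.
   Context: For sets $S,T$, the subset complement $S\mathbin{\dot\setminus}T$ equals $S\setminus T$ if $T\subseteq S$, and is undefined otherwise. Structures may be empty in signatures without $0$. A $(K,\cdot,0)$-structure has a ternary relation $K$, a total binary operation $\cdot$ and a constant $0$; a $(K,\cdot)$-structure omits $0$. A $(K,\cdot,0)$-structure $\mathfrak A$ is $(\dot\setminus,\cap,\emptyset)$-representable by sets if there is a set $X$ and an injection $\theta:\mathfrak A\to\wp(X)$ whose image is closed under $\cap$, and under $\dot\setminus$ wherever defined, and contains $\emptyset$, with $(a\cdot b)^\theta=a^\theta\cap b^\theta$, $0^\theta=\emptyset$, and $K(a,b,c)$ if and only if $a^\theta\mathbin{\dot\setminus}b^\theta$ is defined and equal to $c^\theta$. $(\dot\setminus,\cap)$-representability of a $(K,\cdot)$-structure is defined in the same way, omitting the conditions on $0$ and $\emptyset$. $\mathbf{Ax}(K,\cdot,0)$ consists of the following (free variables universally quantified): 1. $K(a,b,c)\wedge K(a,b,c')\to c=c'$; 2. $K(a,b,c)\wedge K(a',b,c)\to a=a'$; 3. $K(a,b,c)\leftrightarrow K(a,c,b)$; 4. $\cdot$ is commutative, associative and idempotent; 5. $K(b,c,d)\to K(a\cdot b,a\cdot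 c,a\cdot d)$; 6. $K(a,0,a)$; 7. $\exists c\,K(a,b,c)\leftrightarrow a\cdot b=b$. $\mathbf{Ax}(K,\cdot)$ is obtained from $\mathbf{Ax}(K,\cdot,0)$ by replacing axiom 6 by the axiom $\neg\exists a\,\top\ \vee\ \exists z\,\forall a\,K(a,z,a)$ (which says that if the structure is nonempty then some element $z$ satisfies $K(a,z,a)$ for all $a$). *)

theory Defs
  imports Main
begin

text \<open>
  Structures carry an explicit universe, since a structure without zero may be empty.
  The fields are only meaningful on the universe.
\<close>

record 'a K_structure =
  univ :: "'a set"
  Krel :: "'a \<Rightarrow> 'a \<Rightarrow> 'a \<Rightarrow> bool"
  dot :: "'a \<Rightarrow> 'a \<Rightarrow> 'a"

record 'a K0_structure = "'a K_structure" +
  zero :: 'a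

definition is_K_structure :: "('a, 'm) K_structure_scheme \<Rightarrow> bool" where
  "is_K_structure A \<longleftrightarrow> (\<forall>a\<in>univ A. \<forall>b\<in>univ A. dot A a b \<in> univ A)"

definition is_K0_structure :: "('a, 'm) K0_structure_scheme \<Rightarrow> bool" where
  "is_K0_structure A \<longleftrightarrow> is_K_structure A \<and> zero A \<in> univ A"

definition subset_compl :: "'x set \<Rightarrow> 'x set \<Rightarrow> 'x set option" where
  "subset_compl S T = (if T \<subseteq> S then Some (S - T) else None)"

definition K_representation ::
    "('a, 'm) K_structure_scheme \<Rightarrow> 'x set \<Rightarrow> ('a \<Rightarrow> 'x set) \<Rightarrow> bool" where
  "K_representation A X \<theta> \<longleftrightarrow>
     \<theta> ` univ A \<subseteq> Pow X \<and>
     inj_on \<theta> (univ A) \<and>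
     (\<forall>S\<in>\<theta> ` univ A. \<forall>T\<in>\<theta> ` univ A. S \<inter> T \<in> \<theta> ` univ A) \<and>
     (\<forall>S\<in>\<theta> ` univ A. \<forall>T\<in>\<theta> ` univ A. \<forall>U.
        subset_compl S T = Some U \<longrightarrow> U \<in> \<theta> ` univ A) \<and>
     (\<forall>a\<in>univ A. \<forall>b\<in>univ A. \<theta> (dot A a b) = \<theta> a \<inter> \<theta> b) \<and>
     (\<forall>a\<in>univ A. \<forall>b\<in>univ A. \<forall>c\<in>univ A.
        Krel A a b c \<longleftrightarrow> subset_compl (\<theta> a) (\<theta> b) = Some (\<theta> c))"

definition K0_representation ::
    "('a, 'm) K0_structure_scheme \<Rightarrow> 'x set \<Rightarrow> ('a \<Rightarrow> 'x set) \<Rightarrow> bool" where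
  "K0_representation A X \<theta> \<longleftrightarrow>
     K_representation A X \<theta> \<and> {} \<in> \<theta> ` univ A \<and> \<theta> (zero A) = {}"

text \<open>
  HOL cannot quantify existentially over the type of the points of the base set, so this type
  is a parameter. For a structure over \<open>'a\<close>, the type \<open>'a set\<close> loses no generality:
  given any representation \<open>\<theta>\<close>, a point \<open>x\<close> may be replaced by \<open>{a \<in> univ A. x \<in> \<theta> a}\<close>.
\<close>

definition K_representable :: "'x itself \<Rightarrow> ('a, 'm) K_structure_scheme \<Rightarrow> bool" where
  "K_representable T A \<longleftrightarrow> (\<exists>(X :: 'x set) \<theta>. K_representation A X \<theta>)"

definition K0_representable :: "'x itself \<Rightarrow> ('a, 'm) K0_structure_scheme \<Rightarrow> bool" where
  "K0_representable T A \<longleftrightarrow> (\<exists>(X :: 'x set) \<theta>. K0_representation A X \<theta>)"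

definition Ax_common :: "('a, 'm) K_structure_scheme \<Rightarrow> bool" where
  "Ax_common A \<longleftrightarrow>
     (\<forall>a\<in>univ A. \<forall>b\<in>univ A. \<forall>c\<in>univ A. \<forall>c'\<in>univ A.
        Krel A a b c \<and> Krel A a b c' \<longrightarrow> c = c') \<and>
     (\<forall>a\<in>univ A. \<forall>a'\<in>univ A. \<forall>b\<in>univ A. \<forall>c\<in>univ A.
        Krel A a b c \<and> Krel A a' b c \<longrightarrow> a = a') \<and>
     (\<forall>a\<in>univ A. \<forall>b\<in>univ A. \<forall>c\<in>univ A. Krel A a b c \<longleftrightarrow> Krel A a c b) \<and>
     (\<forall>a\<in>univ A. \<forall>b\<in>univ A. dot A a b = dot A b a) \<and>
     (\<forall>a\<in>univ A. \<forall>b\<in>univ A. \<forall>c\<in>univ A.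
        dot A (dot A a b) c = dot A a (dot A b c)) \<and>
     (\<forall>a\<in>univ A. dot A a a = a) \<and>
     (\<forall>a\<in>univ A. \<forall>b\<in>univ A. \<forall>c\<in>univ A. \<forall>d\<in>univ A.
        Krel A b c d \<longrightarrow> Krel A (dot A a b) (dot A a c) (dot A a d)) \<and>
     (\<forall>a\<in>univ A. \<forall>b\<in>univ A. (\<exists>c\<in>univ A. Krel A a b c) \<longleftrightarrow> dot A a b = b)"

definition Ax_K0 :: "('a, 'm) K0_structure_scheme \<Rightarrow> bool" where
  "Ax_K0 A \<longleftrightarrow> Ax_common A \<and> (\<forall>a\<in>univ A. Krel A a (zero A) a)"

definition Ax_K :: "('a, 'm) K_structure_scheme \<Rightarrow> bool" where
  "Ax_K A \<longleftrightarrow> Ax_common A \<and>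
     (\<not> (\<exists>a\<in>univ A. True) \<or> (\<exists>z\<in>univ A. \<forall>a\<in>univ A. Krel A a z a))"

end

theory Submission
  imports Defs
begin

text \<open>
  Soundness is a computation with sets. For completeness, axioms 1, 3, 5 and 6 (or its
  replacement) show that the complement \<open>c\<close> of \<open>b\<close> in \<open>a\<close>
  satisfies \<open>b \<cdot> c = 0\<close>, and that \<open>h \<cdot> b = h \<cdot> c = 0\<close> forces
  \<open>h \<cdot> a = 0\<close>. Hence every maximal proper filter containing \<open>a\<close> contains exactly
  one of \<open>b\<close> and \<open>c\<close>, and sending \<open>a\<close> to the set of prime filters containing \<open>a\<close>
  is a representation. It is injective since for \<open>a \<cdot> b \<noteq> a\<close> the complement of
  \<open>a \<cdot> b\<close> in \<open>a\<close> is nonzero and so, by Zorn's lemma, lies in a maximal proper filter.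
\<close>

section \<open>Soundness\<close>

lemma subset_compl_eq_Some_iff:
  "subset_compl S T = Some U \<longleftrightarrow> T \<subseteq> S \<and> S - T = U"
  by (auto simp: subset_compl_def)

text \<open>Injectivity turns every equation between elements into one between sets, after which the
  axioms become set identities. Closure under subset complement enters only through
  \<open>diff\<close>, which supplies the element \<open>c\<close> in the last axiom.\<close>

lemma Ax_common_if_representation:
  assumes str: "is_K_structure A" and rep: "K_representation A X \<theta>"
  shows "Ax_common A"
proof -
  have dotc: "dot A a b \<in> univ A" if "a \<in> univ A" "b \<in> univ A" for a b
    using str that by (auto simp: is_K_structure_def)
  have dot: "\<theta> (dot A a b) = \<theta> a \<inter> \<theta> b" if "a \<in> univ A" "b \<in> univ A" for a b
    using rep that by (auto simp: K_representation_def)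
  have K: "Krel A a b c \<longleftrightarrow> \<theta> b \<subseteq> \<theta> a \<and> \<theta> a - \<theta> b = \<theta> c"
    if "a \<in> univ A" "b \<in> univ A" "c \<in> univ A" for a b c
    using rep that by (auto simp: K_representation_def subset_compl_eq_Some_iff)
  have inj: "a = b \<longleftrightarrow> \<theta> a = \<theta> b" if "a \<in> univ A" "b \<in> univ A" for a b
    using rep that by (auto simp: K_representation_def inj_on_def)
  have diff: "\<exists>c\<in>univ A. \<theta> a - \<theta> b = \<theta> c"
    if "a \<in> univ A" "b \<in> univ A" "\<theta> b \<subseteq> \<theta> a" for a b
  proof -
    have "\<forall>S\<in>\<theta> ` univ A. \<forall>T\<in>\<theta> ` univ A. \<forall>U.
        subset_compl S T = Some U \<longrightarrow> U \<in> \<theta> ` univ A"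
      using rep unfolding K_representation_def by (elim conjE)
    from this[rule_format, of "\<theta> a" "\<theta> b" "\<theta> a - \<theta> b"] show ?thesis
      using that by (auto simp: subset_compl_eq_Some_iff image_iff)
  qed
  show ?thesis
    unfolding Ax_common_def
  proof (intro conjI ballI impI)
    fix a b assume ab: "a \<in> univ A" "b \<in> univ A"
    show "(\<exists>c\<in>univ A. Krel A a b c) \<longleftrightarrow> dot A a b = b"
      using diff[OF ab] K[OF ab] inj[OF dotc[OF ab] ab(2)] dot[OF ab] by auto
  next
    fix a b c d assume "a \<in> univ A" "b \<in> univ A" "c \<in> univ A" "d \<in> univ A" "Krel A b c d"
    then show "Krel A (dot A a b) (dot A a c) (dot A a d)"
      using K[of b c d] by (auto simp: K dotc dot)
  qed (auto simp: K inj dot dotc)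
qed

lemma Krel_empty_if_representation:
  assumes "K_representation A X \<theta>" "z \<in> univ A" "\<theta> z = {}" "a \<in> univ A"
  shows "Krel A a z a"
  using assms by (auto simp: K_representation_def subset_compl_eq_Some_iff)

lemma Ax_K0_if_representable:
  assumes "is_K0_structure A" "K0_representable TYPE('x) A"
  shows "Ax_K0 A"
  using assms Ax_common_if_representation Krel_empty_if_representation
  unfolding is_K0_structure_def K0_representable_def K0_representation_def Ax_K0_def
  by metis

lemma Ax_K_if_representable:
  assumes "is_K_structure A" "K_representable TYPE('x) A"
  shows "Ax_K A"
proof -
  obtain X :: "'x set" and \<theta> where rep: "K_representation A X \<theta>"
    using assms(2) by (auto simp: K_representable_def)
  \<comment> \<open>Any \<open>a\<close> yields a zero: the complement of \<open>\<theta> a\<close>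
    in itself is empty and lies in the image by closure.\<close>
  have "\<exists>z\<in>univ A. \<theta> z = {}" if "a \<in> univ A" for a
  proof -
    have "\<forall>U. subset_compl (\<theta> a) (\<theta> a) = Some U \<longrightarrow> U \<in> \<theta> ` univ A"
      using rep that by (auto simp: K_representation_def)
    then show ?thesis
      by (force simp: subset_compl_eq_Some_iff)
  qed
  then show ?thesis
    using Ax_common_if_representation[OF assms(1) rep] Krel_empty_if_representation[OF rep]
    unfolding Ax_K_def by blast
qed

section \<open>Completeness\<close>

text \<open>With \<open>x \<le> y\<close> meaning \<open>x \<cdot> y = x\<close>, the biconditional
  encodes both closure under products and upward closure. The empty set qualifies, which is harmless
  because only filters containing a given element are ever collected.\<close>

definition proper_filter :: "('a, 'm) K_structure_scheme \<Rightarrow> 'a \<Rightarrow> 'a set \<Rightarrow> bool" where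
  "proper_filter A z F \<longleftrightarrow> F \<subseteq> univ A \<and> z \<notin> F \<and>
     (\<forall>x\<in>univ A. \<forall>y\<in>univ A. dot A x y \<in> F \<longleftrightarrow> x \<in> F \<and> y \<in> F)"

text \<open>There is no join, so primality is stated for the decompositions of \<open>a\<close>
  recorded by \<open>Krel\<close>.\<close>

definition prime_filter :: "('a, 'm) K_structure_scheme \<Rightarrow> 'a \<Rightarrow> 'a set \<Rightarrow> bool" where
  "prime_filter A z F \<longleftrightarrow> proper_filter A z F \<and>
     (\<forall>a\<in>F. \<forall>b\<in>univ A. \<forall>c\<in>univ A. Krel A a b c \<longrightarrow> b \<in> F \<or> c \<in> F)"

text \<open>The zero is a parameter, so that it can be either the named constant or a witness of the
  existential axiom.\<close>

locale K_axioms =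
  fixes A :: "('a, 'm) K_structure_scheme" (structure) and z :: 'a
  assumes str: "is_K_structure A" and Ax: "Ax_common A"
    and z: "z \<in> univ A" and Kz: "a \<in> univ A \<Longrightarrow> Krel A a z a"
begin

section \<open>Arithmetic of products and complements\<close>

abbreviation U where "U \<equiv> univ A"
abbreviation mult (infixl "\<cdot>" 70) where "x \<cdot> y \<equiv> dot A x y"

lemma closed [simp]: "a \<in> U \<Longrightarrow> b \<in> U \<Longrightarrow> a \<cdot> b \<in> U"
  using str by (auto simp: is_K_structure_def)

lemma K_unique: "Krel A a b c \<Longrightarrow> Krel A a b c' \<Longrightarrow> a \<in> U \<Longrightarrow> b \<in> U \<Longrightarrow> c \<in> U \<Longrightarrow> c' \<in> U \<Longrightarrow> c = c'"
  using Ax unfolding Ax_common_def by metis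

lemma K_sym: "Krel A a b c \<Longrightarrow> a \<in> U \<Longrightarrow> b \<in> U \<Longrightarrow> c \<in> U \<Longrightarrow> Krel A a c b"
  using Ax unfolding Ax_common_def by metis

lemma comm: "a \<in> U \<Longrightarrow> b \<in> U \<Longrightarrow> a \<cdot> b = b \<cdot> a"
  using Ax unfolding Ax_common_def by metis

lemma assoc: "a \<in> U \<Longrightarrow> b \<in> U \<Longrightarrow> c \<in> U \<Longrightarrow> a \<cdot> b \<cdot> c = a \<cdot> (b \<cdot> c)"
  using Ax unfolding Ax_common_def by metis

lemma idem [simp]: "a \<in> U \<Longrightarrow> a \<cdot> a = a"
  using Ax unfolding Ax_common_def by metis

lemma left_comm: "a \<in> U \<Longrightarrow> b \<in> U \<Longrightarrow> c \<in> U \<Longrightarrow> a \<cdot> (b \<cdot> c) = b \<cdot> (a \<cdot> c)"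
  by (metis assoc comm)

lemma left_idem [simp]: "a \<in> U \<Longrightarrow> b \<in> U \<Longrightarrow> a \<cdot> (a \<cdot> b) = a \<cdot> b"
  by (metis assoc idem)

lemma K_mult:
  "Krel A b c d \<Longrightarrow> a \<in> U \<Longrightarrow> b \<in> U \<Longrightarrow> c \<in> U \<Longrightarrow> d \<in> U \<Longrightarrow> Krel A (a \<cdot> b) (a \<cdot> c) (a \<cdot> d)"
  using Ax unfolding Ax_common_def by metis

lemma K_ex_iff: "a \<in> U \<Longrightarrow> b \<in> U \<Longrightarrow> (\<exists>c\<in>U. Krel A a b c) \<longleftrightarrow> a \<cdot> b = b"
  using Ax unfolding Ax_common_def by metis

lemma K_le: "Krel A a b c \<Longrightarrow> a \<in> U \<Longrightarrow> b \<in> U \<Longrightarrow> c \<in> U \<Longrightarrow> a \<cdot> b = b"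
  using K_ex_iff by blast

lemma mult_z [simp]: "a \<in> U \<Longrightarrow> a \<cdot> z = z"
  using K_le Kz z by blast

lemma z_mult [simp]: "a \<in> U \<Longrightarrow> z \<cdot> a = z"
  by (metis comm mult_z z)

text \<open>Multiplying by \<open>b\<close> gives \<open>Krel A b b (b \<cdot> c)\<close>, while
  symmetry turns \<open>Krel A b z b\<close> into \<open>Krel A b b z\<close>. Uniqueness of
  complements identifies the two.\<close>

lemma K_disjoint:
  assumes "Krel A a b c" and [simp]: "a \<in> U" "b \<in> U" "c \<in> U"
  shows "b \<cdot> c = z"
proof -
  have "b \<cdot> a = b" using K_le[OF assms] by (simp add: comm)
  then have "Krel A b b (b \<cdot> c)" using K_mult[OF assms(1), of b] by simp
  moreover have "Krel A b b z" using Kz[of b] K_sym z by simp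
  ultimately show ?thesis using K_unique z by simp
qed

text \<open>Multiplying by \<open>h\<close> makes \<open>z\<close> the complement of
  \<open>z\<close> in \<open>h \<cdot> a\<close>, but that complement is \<open>h \<cdot> a\<close>
  itself.\<close>

lemma K_cover:
  assumes "Krel A a b c" and [simp]: "a \<in> U" "b \<in> U" "c \<in> U" "h \<in> U"
    and "h \<cdot> b = z" "h \<cdot> c = z"
  shows "h \<cdot> a = z"
proof -
  have "Krel A (h \<cdot> a) z z" using K_mult[OF assms(1), of h] assms by simp
  then show ?thesis using K_unique[of "h \<cdot> a" z z "h \<cdot> a"] Kz[of "h \<cdot> a"] z by simp
qed

section \<open>Filters and the existence of prime filters\<close>

lemma filter_mult:
  "proper_filter A z F \<Longrightarrow> x \<in> U \<Longrightarrow> y \<in> U \<Longrightarrow> x \<cdot> y \<in> F \<longleftrightarrow> x \<in> F \<and> y \<in> F"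
  by (auto simp: proper_filter_def)

lemma filter_subset: "proper_filter A z F \<Longrightarrow> x \<in> F \<Longrightarrow> x \<in> U"
  by (auto simp: proper_filter_def)

lemma proper_filter_principal:
  assumes [simp]: "d \<in> U" and "d \<noteq> z"
  shows "proper_filter A z {x \<in> U. d \<cdot> x = d}"
proof -
  have "d \<cdot> (x \<cdot> y) = d \<longleftrightarrow> d \<cdot> x = d \<and> d \<cdot> y = d" if [simp]: "x \<in> U" "y \<in> U" for x y
  proof
    assume eq: "d \<cdot> (x \<cdot> y) = d"
    have "d \<cdot> x = d" using eq by (metis assms(1) assoc closed comm left_idem that)
    moreover have "d \<cdot> y = d" using eq by (metis assms(1) assoc closed idem that)
    ultimately show "d \<cdot> x = d \<and> d \<cdot> y = d" by blast
  qed (simp flip: assoc)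
  then show ?thesis using assms z by (auto simp: proper_filter_def)
qed

text \<open>For nonempty \<open>F\<close> this is the filter generated by \<open>F\<close> and
  \<open>b\<close>. It is the union of the principal filters of \<open>f \<cdot> b\<close>, each
  proper by \<open>nz\<close>, and the union is directed because
  \<open>f \<cdot> g \<cdot> b\<close> lies below both \<open>f \<cdot> b\<close> and
  \<open>g \<cdot> b\<close>.\<close>

lemma proper_filter_adjoin:
  assumes F: "proper_filter A z F" and [simp]: "b \<in> U" and nz: "\<forall>f\<in>F. f \<cdot> b \<noteq> z"
  shows "proper_filter A z {x \<in> U. \<exists>f\<in>F. f \<cdot> b \<cdot> x = f \<cdot> b}"
proof -
  note [simp] = filter_subset[OF F]
  let ?G = "\<lambda>f. {x \<in> U. f \<cdot> b \<cdot> x = f \<cdot> b}"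
  have G: "proper_filter A z (?G f)" if "f \<in> F" for f
    using that nz by (intro proper_filter_principal) auto
  have mono: "x \<in> ?G (f \<cdot> g)" if "x \<in> ?G f" "f \<in> F" "g \<in> F" for x f g
  proof -
    have [simp]: "x \<in> U" "f \<in> U" "g \<in> U" and "f \<cdot> b \<cdot> x = f \<cdot> b" using that by auto
    moreover have "f \<cdot> g \<cdot> b = g \<cdot> (f \<cdot> b)" by (simp add: assoc left_comm)
    ultimately show ?thesis by (simp add: assoc)
  qed
  have eq: "{x \<in> U. \<exists>f\<in>F. f \<cdot> b \<cdot> x = f \<cdot> b} = (\<Union>f\<in>F. ?G f)" by auto
  have fwd: "x \<cdot> y \<in> (\<Union>f\<in>F. ?G f)"
    if "x \<in> U" "y \<in> U" "x \<in> ?G f" "y \<in> ?G g" "f \<in> F" "g \<in> F" for x y f g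
  proof -
    have fg: "f \<cdot> g \<in> F" using that filter_mult[OF F] by simp
    have "x \<in> ?G (f \<cdot> g)" using mono that by blast
    moreover have "y \<in> ?G (f \<cdot> g)" using mono[of y g f] that comm[of f g] by simp
    ultimately show ?thesis using filter_mult[OF G[OF fg]] that fg by blast
  qed
  have "x \<cdot> y \<in> (\<Union>f\<in>F. ?G f) \<longleftrightarrow> x \<in> (\<Union>f\<in>F. ?G f) \<and> y \<in> (\<Union>f\<in>F. ?G f)"
    if "x \<in> U" "y \<in> U" for x y
  proof
    assume "x \<cdot> y \<in> (\<Union>f\<in>F. ?G f)"
    then obtain f where f: "f \<in> F" "x \<cdot> y \<in> ?G f" by (elim UN_E)
    then have "x \<in> ?G f" "y \<in> ?G f" using filter_mult[OF G] that by blast+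
    then show "x \<in> (\<Union>f\<in>F. ?G f) \<and> y \<in> (\<Union>f\<in>F. ?G f)"
      using f(1) by (intro conjI UN_I)
  next
    assume "x \<in> (\<Union>f\<in>F. ?G f) \<and> y \<in> (\<Union>f\<in>F. ?G f)"
    then show "x \<cdot> y \<in> (\<Union>f\<in>F. ?G f)"
      using fwd[OF that] by (elim conjE UN_E)
  qed
  moreover have "z \<notin> (\<Union>f\<in>F. ?G f)"
    using G by (auto simp: proper_filter_def)
  moreover have "(\<Union>f\<in>F. ?G f) \<subseteq> U" by auto
  ultimately show ?thesis
    unfolding eq unfolding proper_filter_def by (intro conjI ballI)
qed

text \<open>Zorn's lemma, started from the principal filter of \<open>d\<close>, gives a maximal
  proper filter containing \<open>d\<close>; maximality then forces primality.\<close>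

lemma prime_filter_exists:
  assumes d: "d \<in> U" "d \<noteq> z"
  obtains F where "prime_filter A z F" "d \<in> F"
proof -
  let ?\<F> = "{F. proper_filter A z F \<and> d \<in> F}"
  have "?\<F> \<noteq> {}" using proper_filter_principal[OF d] d by auto
  moreover have "\<Union>C \<in> ?\<F>" if C: "C \<noteq> {}" "subset.chain ?\<F> C" for C
  proof -
    have mem: "proper_filter A z F" "d \<in> F" if "F \<in> C" for F
      using C that by (auto simp: subset_chain_def)
    have "x \<cdot> y \<in> \<Union>C \<longleftrightarrow> x \<in> \<Union>C \<and> y \<in> \<Union>C" if xy: "x \<in> U" "y \<in> U" for x y
    proof
      assume "x \<cdot> y \<in> \<Union>C"
      then show "x \<in> \<Union>C \<and> y \<in> \<Union>C"
        using filter_mult[OF mem(1) xy] by blast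
    next
      assume "x \<in> \<Union>C \<and> y \<in> \<Union>C"
      then obtain F G where FG: "F \<in> C" "G \<in> C" "x \<in> F" "y \<in> G" by blast
      then have "F \<subseteq> G \<or> G \<subseteq> F" using C by (auto simp: subset_chain_def)
      then show "x \<cdot> y \<in> \<Union>C" using FG filter_mult[OF mem(1) xy] by blast
    qed
    moreover have "\<Union>C \<subseteq> U" "z \<notin> \<Union>C" using mem by (auto simp: proper_filter_def)
    ultimately have "proper_filter A z (\<Union>C)"
      unfolding proper_filter_def by (intro conjI ballI)
    moreover have "d \<in> \<Union>C" using C(1) mem(2) by auto
    ultimately show ?thesis by simp
  qed
  ultimately obtain F where F: "proper_filter A z F" and dF: "d \<in> F"
    and max: "\<And>G. proper_filter A z G \<Longrightarrow> d \<in> G \<Longrightarrow> F \<subseteq> G \<Longrightarrow> G = F"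
    using subset_Zorn_nonempty[of ?\<F>] by auto
  note [simp] = filter_subset[OF F]
  \<comment> \<open>An element outside \<open>F\<close> is annihilated by a member of
    \<open>F\<close>, since otherwise adjoining it would give a strictly larger proper
    filter.\<close>
  have meets: "\<exists>f\<in>F. f \<cdot> b = z" if [simp]: "b \<in> U" and "b \<notin> F" for b
  proof (rule ccontr)
    assume no: "\<not> (\<exists>f\<in>F. f \<cdot> b = z)"
    let ?G = "{x \<in> U. \<exists>f\<in>F. f \<cdot> b \<cdot> x = f \<cdot> b}"
    have "f \<cdot> b \<cdot> f = f \<cdot> b" if "f \<in> F" for f
      using that by (simp add: comm[of "f \<cdot> b" f])
    then have FG: "F \<subseteq> ?G" by auto
    have "proper_filter A z ?G" using proper_filter_adjoin[OF F] no by simp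
    then have "?G = F" using max dF FG by (meson subsetD)
    \<comment> \<open>The member \<open>d\<close> of \<open>F\<close> witnesses that
      \<open>b\<close> belongs to the enlarged filter.\<close>
    moreover have "d \<cdot> b \<cdot> b = d \<cdot> b" using dF by (simp add: assoc)
    then have "b \<in> ?G" using dF that(1) by blast
    ultimately show False using \<open>b \<notin> F\<close> by metis
  qed
  have "b \<in> F \<or> c \<in> F" if a: "a \<in> F" and bc [simp]: "b \<in> U" "c \<in> U" and K: "Krel A a b c" for a b c
  proof (rule ccontr)
    assume "\<not> (b \<in> F \<or> c \<in> F)"
    then obtain f g where f: "f \<in> F" "f \<cdot> b = z" and g: "g \<in> F" "g \<cdot> c = z"
      using meets[OF bc(1)] meets[OF bc(2)] by blast
    have [simp]: "a \<in> U" "f \<in> U" "g \<in> U" using a f g by auto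
    \<comment> \<open>The product \<open>f \<cdot> g\<close> annihilates both \<open>b\<close> and
      \<open>c\<close>, hence also \<open>a\<close>; as \<open>f\<close>, \<open>g\<close> and
      \<open>a\<close> all lie in \<open>F\<close>, so would \<open>z\<close>.\<close>
    have "f \<cdot> g \<cdot> b = g \<cdot> (f \<cdot> b)" by (simp add: assoc left_comm)
    then have "f \<cdot> g \<cdot> b = z" using f by simp
    moreover have "f \<cdot> g \<cdot> c = z" using g by (simp add: assoc)
    ultimately have "f \<cdot> g \<cdot> a = z" using K_cover[OF K] by simp
    then have "z \<in> F" using filter_mult[OF F] a f(1) g(1) by (metis closed filter_subset[OF F])
    then show False using F by (simp add: proper_filter_def)
  qed
  then have "prime_filter A z F" using F by (simp add: prime_filter_def)
  then show ?thesis using that dF by blast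
qed

section \<open>The representation by prime filters\<close>

definition stone :: "'a \<Rightarrow> 'a set set" where
  "stone a = {F. prime_filter A z F \<and> a \<in> F}"

lemma stone_z: "stone z = {}"
  by (auto simp: stone_def prime_filter_def proper_filter_def)

lemma stone_mult: "a \<in> U \<Longrightarrow> b \<in> U \<Longrightarrow> stone (a \<cdot> b) = stone a \<inter> stone b"
  by (auto simp: stone_def prime_filter_def filter_mult)

lemma stone_K:
  assumes K: "Krel A a b c" and [simp]: "a \<in> U" "b \<in> U" "c \<in> U"
  shows "stone b \<subseteq> stone a \<and> stone a - stone b = stone c"
proof -
  have "stone b \<subseteq> stone a"
    using stone_mult[of a b] K_le[OF K] by auto
  moreover have "stone c \<subseteq> stone a"
    using stone_mult[of a c] K_le[OF K_sym[OF K]] by auto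
  moreover have "stone b \<inter> stone c = {}"
    using stone_mult[of b c] K_disjoint[OF K] stone_z by simp
  moreover have "stone a \<subseteq> stone b \<union> stone c"
    using assms unfolding stone_def prime_filter_def by blast
  ultimately show ?thesis by blast
qed

text \<open>The complement \<open>d\<close> of \<open>a \<cdot> b\<close> in \<open>a\<close> lies
  in no prime filter, so it is \<open>z\<close>. Then \<open>a \<cdot> b\<close> and
  \<open>a\<close> are both complements of \<open>z\<close> in \<open>a\<close>, hence
  equal.\<close>

lemma le_if_stone_subset:
  assumes [simp]: "a \<in> U" "b \<in> U" and sub: "stone a \<subseteq> stone b"
  shows "a \<cdot> b = a"
proof -
  obtain d where [simp]: "d \<in> U" and K: "Krel A a (a \<cdot> b) d"
    using K_ex_iff[of a "a \<cdot> b"] by auto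
  have "stone d = {}"
    using stone_K[OF K] stone_mult[of a b] sub by auto
  then have "d = z"
    using prime_filter_exists[of d] by (auto simp: stone_def)
  then have "Krel A a z (a \<cdot> b)" using K_sym[OF K] z by simp
  then show ?thesis using K_unique[of a z "a \<cdot> b" a] Kz z by simp
qed

lemma inj_on_stone: "inj_on stone U"
  by (rule inj_onI) (metis comm le_if_stone_subset order_refl)

lemma K_representation_stone: "K_representation A UNIV stone"
proof -
  have ex: "\<exists>c\<in>U. Krel A a b c"
    if [simp]: "a \<in> U" "b \<in> U" and "stone b \<subseteq> stone a" for a b
    using that le_if_stone_subset[of b a] by (simp add: K_ex_iff comm)
  \<comment> \<open>For the converse, \<open>ex\<close> gives some complement of \<open>b\<close> in
    \<open>a\<close>; its image is \<open>stone a - stone b = stone c\<close>, so by injectivity it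
    is \<open>c\<close>.\<close>
  have iff: "Krel A a b c \<longleftrightarrow> stone b \<subseteq> stone a \<and> stone a - stone b = stone c"
    if "a \<in> U" "b \<in> U" "c \<in> U" for a b c
    using that ex[of a b] stone_K inj_onD[OF inj_on_stone] by metis
  have "stone a - stone b \<in> stone ` U" if "a \<in> U" "b \<in> U" "stone b \<subseteq> stone a" for a b
    using ex[OF that] stone_K that by blast
  moreover have "stone a \<inter> stone b \<in> stone ` U" if "a \<in> U" "b \<in> U" for a b
    using stone_mult that by (metis closed imageI)
  ultimately show ?thesis
    using iff by (auto simp: K_representation_def subset_compl_eq_Some_iff inj_on_stone stone_mult)
qed

end

section \<open>Completeness in the two signatures\<close>

lemma K0_representable_if_Ax_K0:
  fixes A :: "('a, 'm) K0_structure_scheme"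
  assumes "is_K0_structure A" "Ax_K0 A"
  shows "K0_representable TYPE('a set) A"
proof -
  interpret K_axioms A "zero A"
    using assms by unfold_locales (auto simp: is_K0_structure_def Ax_K0_def)
  have "{} \<in> stone ` univ A"
    using stone_z z by force
  then show ?thesis
    using K_representation_stone stone_z
    unfolding K0_representable_def K0_representation_def by blast
qed

lemma K_representable_if_Ax_K:
  fixes A :: "('a, 'm) K_structure_scheme"
  assumes "is_K_structure A" "Ax_K A"
  shows "K_representable TYPE('a set) A"
proof (cases "univ A = {}")
  case True
  \<comment> \<open>Over an empty universe every condition is vacuous, so any map is a
    representation.\<close>
  then show ?thesis by (auto simp: K_representable_def K_representation_def)
next
  case False
  then obtain z where "z \<in> univ A" "\<forall>a\<in>univ A. Krel A a z a"
    using assms(2) by (auto simp: Ax_K_def)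
  then interpret K_axioms A z
    using assms by unfold_locales (auto simp: Ax_K_def)
  show ?thesis using K_representation_stone by (auto simp: K_representable_def)
qed

text \<open>Completeness produces filters as points, hence the type \<open>'a set\<close>; soundness
  holds for points of any type \<open>'x\<close>. Together they show that representability over some
  type already gives it over \<open>'a set\<close>.\<close>

theorem theorem6p3:
  fixes A :: "'a K0_structure" and B :: "'a K_structure"
  shows "(is_K0_structure A \<longrightarrow>
            (K0_representable TYPE('a set) A \<longleftrightarrow> Ax_K0 A) \<and>
            (K0_representable TYPE('x) A \<longrightarrow> Ax_K0 A)) \<and>
         (is_K_structure B \<longrightarrow>
            (K_representable TYPE('a set) B \<longleftrightarrow> Ax_K B) \<and>
            (K_representable TYPE('x) B \<longrightarrow> Ax_K B))"
  by (intro conjI impI iffI; fact Ax_K0_if_representable K0_representable_if_Ax_K0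
      Ax_K_if_representable K_representable_if_Ax_K)

end
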